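(* Let $b,\rho\in\mathbb{C}$ with $\operatorname{Re}(\rho)>0$ and let $z\in\mathbb{C}\setminus(-\infty,0]$. (i) If $\mu,\nu,c\in\mathbb{C}$ with $\operatorname{Re}(\mu)>-1$, $\operatorname{Re}(\nu)>-\tfrac32$, $\operatorname{Re}(c)>\tfrac12$, then $$g_\nu^{(b,c)}(z;\rho)=\frac{\sqrt\pi}2\,\frac{\Gamma(\mu+1)}{[\Gamma(\nu+\frac32)]^2}\sum_{m=0}^\infty\sum_{n=0}^\infty\Big(\frac z2\Big)^{\nu-\mu+m+n}J_{\mu+m+n}(z)\,\frac{(-m-n)_n\,b^n\,(c-\frac12;\rho)_{2n+\nu+\frac12}\,(\mu+1)_n}{n!\,(\nu+\frac32)_n\,(\nu+\frac32)_{2n}\,(m+n)!}.$$ (ii) If $\nu,\lambda\in\mathbb{C}$ with $\operatorname{Re}(\nu)>-1$, $\operatorname{Re}(\lambda)>0$, then $$C_\nu^{(b,\lambda)}(z;\rho)=\frac1{[\Gamma(\nu+1)]^2}\sum_{m=0}^\infty\sum_{n=0}^\infty\frac{z^m\,2^{n-m}\,J_{m+n}(z)\,(-m-n)_n\,(-b)^n\,(\lambda;\rho)_{\nu+2n}}{(m+n)!\,(-1)^n\,(\nu+1)_n\,(\nu+1)_{2n}}.$$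
   Context: For $\rho\in\mathbb{C}$ with $\operatorname{Re}(\rho)>0$ and $x\in\mathbb{C}$ put $\Gamma_\rho(x)=\int_0^\infty t^{x-1}e^{-t-\rho/t}\,dt$. The generalized Pochhammer symbol is $(\lambda;\rho)_\nu:=\Gamma_\rho(\lambda+\nu)/\Gamma(\lambda)$. The unified four parameter Bessel function is $G_\nu^{(b,c)}(z;\rho):=\sum_{k=0}^\infty \frac{(-b)^k (c;\rho)_{2k+\nu}}{\Gamma(\nu+k+1)\,\Gamma(\nu+2k+1)}\,\frac{(z/2)^{2k+\nu}}{k!}$. The generalized four parameter spherical Bessel and Bessel-Clifford functions are $$g_\nu^{(b,c)}(z;\rho):=\sqrt{\tfrac{\pi}{2z}}\,G_{\nu+\frac12}^{(b,c-\frac12)}(z;\rho)=\frac{\sqrt\pi}{2}\sum_{k=0}^\infty\frac{(-b)^k(c-\frac12;\rho)_{2k+\nu+\frac12}}{k!\,\Gamma(\nu+k+\frac32)\,\Gamma(\nu+2k+\frac32)}\Big(\frac z2\Big)^{2k+\nu},$$ $$C_\nu^{(b,\lambda)}(z;\rho):=z^{-\nu/2}G_\nu^{(b,\lambda)}(2\sqrt z;\rho)=\sum_{k=0}^\infty\frac{(-b)^k(\lambda;\rho)_{2k+\nu}}{k!\,\Gamma(\nu+k+1)\,\Gamma(\nu+2k+1)}\,z^k.$$ Powers and square roots are principal. $(a)_n=a(a+1)\cdots(a+n-1)$, $(a)_0=1$, is the usual Pochhammer symbol and $J_\nu(z)=\sum_{k=0}^\infty\frac{(-1)^k}{k!\,\Gamma(\nu+k+1)}(z/2)^{2k+\nu}$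 is the usual Bessel function. *)

theory Defs
  imports "HOL-Analysis.Analysis"
begin

text \<open>
  Conventions: \<open>powr\<close> is the principal power and \<open>csqrt\<close> the principal square root.
  Since \<open>Gamma\<close> is 0 at its poles and \<open>x / 0 = 0\<close>, dividing by \<open>Gamma\<close> is
  multiplication by the entire function \<open>rGamma\<close>.  Because \<open>0 powr a = 0\<close> for every \<open>a\<close>,
  the functions of \<open>z\<close> below are meant for \<open>z \<noteq> 0\<close> only.
\<close>

definition Gamma_ext :: "complex \<Rightarrow> complex \<Rightarrow> complex" where
  "Gamma_ext \<rho> x =
     (LINT t:{0<..}|lborel.
        complex_of_real t powr (x - 1) * exp (- complex_of_real t - \<rho> / complex_of_real t))"

definition poch_ext :: "complex \<Rightarrow> complex \<Rightarrow> complex \<Rightarrow> complex" where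
  "poch_ext \<kappa> \<rho> \<nu> = Gamma_ext \<rho> (\<kappa> + \<nu>) / Gamma \<kappa>"

definition Bessel_J :: "complex \<Rightarrow> complex \<Rightarrow> complex" where
  "Bessel_J \<nu> z =
     (\<Sum>k. (-1) ^ k / (fact k * Gamma (\<nu> + of_nat k + 1)) * (z / 2) powr (2 * of_nat k + \<nu>))"

definition Bessel_G :: "complex \<Rightarrow> complex \<Rightarrow> complex \<Rightarrow> complex \<Rightarrow> complex \<Rightarrow> complex" where
  "Bessel_G \<nu> b c z \<rho> =
     (\<Sum>k. (- b) ^ k * poch_ext c \<rho> (2 * of_nat k + \<nu>)
           / (Gamma (\<nu> + of_nat k + 1) * Gamma (\<nu> + 2 * of_nat k + 1))
           * ((z / 2) powr (2 * of_nat k + \<nu>) / fact k))"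

definition spherical_g :: "complex \<Rightarrow> complex \<Rightarrow> complex \<Rightarrow> complex \<Rightarrow> complex \<Rightarrow> complex" where
  "spherical_g \<nu> b c z \<rho> = csqrt (of_real pi / (2 * z)) * Bessel_G (\<nu> + 1/2) b (c - 1/2) z \<rho>"

definition Bessel_Clifford :: "complex \<Rightarrow> complex \<Rightarrow> complex \<Rightarrow> complex \<Rightarrow> complex \<Rightarrow> complex" where
  "Bessel_Clifford \<nu> b \<kappa> z \<rho> = z powr (- \<nu> / 2) * Bessel_G \<nu> b \<kappa> (2 * csqrt z) \<rho>"

text \<open>Convergence of the iterated series \<open>\<Sum>m. \<Sum>n. a m n\<close>; \<open>suminf\<close> alone does not express it.\<close>

definition iterated_summable :: "(nat \<Rightarrow> nat \<Rightarrow> complex) \<Rightarrow> bool" where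
  "iterated_summable a \<longleftrightarrow> (\<forall>m. summable (a m)) \<and> summable (\<lambda>m. \<Sum>n. a m n)"

end

theory Submission
  imports Defs "HOL-Real_Asymp.Real_Asymp"
begin

text \<open>
  Put \<open>w = z / 2\<close> and \<open>u = w\<^sup>2\<close>.  Since \<open>(-m-n)\<^sub>n / (m+n)! = (-1)\<^sup>n / m!\<close>, in both double series
  the index \<open>m\<close> enters only through \<open>w\<^sup>m J\<^bsub>\<mu>+m+n\<^esub>(z) / m!\<close> (with \<open>\<mu> = 0\<close> in the second), and
  the classical Lommel expansion
  \[ \sum_m \frac{w^m}{m!} J_{\mu+n+m}(z) = \frac{w^{\mu+n}}{\Gamma(\mu+n+1)} \]
  sums it out.  What remains is the power series in \<open>n\<close> that defines the left-hand side.  The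
  Lommel expansion holds because, after inserting the series of the Bessel functions, the
  coefficient of \<open>u\<^sup>N\<close> contains \<open>\<Sum>k\<le>N. (-1)\<^sup>k (N choose k)\<close>, which vanishes unless \<open>N = 0\<close>
  (lemma \<open>infsum_scaled_0F1_eq_1\<close>).

  The series in the theorem are summed over \<open>n\<close> first, so the argument needs an interchange.  It
  is justified by absolute convergence.  Write \<open>e\<^sub>n\<close> for the terms of the final power series.  For
  \<open>Re \<mu> > -1\<close> all Pochhammer symbols \<open>(\<mu>+1+n)\<^sub>j\<close> are bounded below in modulus by
  \<open>min 1 (Re \<mu> + 1)\<close>, uniformly in \<open>n\<close> and \<open>j\<close>.  Hence the \<open>(m, n)\<close> term of the double series is at
  most a constant times \<open>\<bar>e\<^sub>n\<bar> \<bar>u\<bar>\<^sup>m / m!\<close>, a product of two summable sequences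
  (\<open>double_Bessel_expansion\<close>).  The numbers \<open>e\<^sub>n\<close> are absolutely summable
  by the ratio test, after \<open>\<bar>\<Gamma>\<^sub>\<rho>(x)\<bar> \<le> \<Gamma>(Re x)\<close> has replaced the extended Gamma function by the
  usual one (\<open>summable_Bessel_G_coeffs\<close>).
\<close>

section \<open>The extended Gamma function\<close>

text \<open>
  For \<open>t > 0\<close> the factor \<open>exp (- \<rho> / t)\<close> has modulus at most 1, so Euler's integral for
  \<open>\<Gamma>(Re x)\<close> dominates.
\<close>
lemma norm_Gamma_ext_le:
  assumes "Re \<rho> \<ge> 0" "Re x > 0"
  shows   "norm (Gamma_ext \<rho> x) \<le> Gamma (Re x)"
proof -
  define g where "g = (\<lambda>t::real. indicator {0<..} t *\<^sub>R
    (complex_of_real t powr (x - 1) * exp (- complex_of_real t - \<rho> / complex_of_real t)))"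
  define h where "h = (\<lambda>t::real. indicator {0..} t *\<^sub>R (t powr (Re x - 1) / exp t))"
  have h: "(\<lambda>t::real. t powr (Re x - 1) / exp t) absolutely_integrable_on {0..}"
    using Gamma_integral_real[OF assms(2)]
    by (intro nonnegative_absolutely_integrable_1) (auto simp: has_integral_integrable)
  have hi: "integrable lborel h"
    using h unfolding set_integrable_def h_def
    by (subst (asm) integrable_completion) auto
  have "integral\<^sup>L lborel h = integral {0..} (\<lambda>t::real. t powr (Re x - 1) / exp t)"
    using set_lebesgue_integral_eq_integral(2)[OF h]
    by (simp add: set_lebesgue_integral_def integral_completion h_def)
  also have "\<dots> = Gamma (Re x)"
    using Gamma_integral_real[OF assms(2)] by (simp add: integral_unique)
  finally have h_eq: "integral\<^sup>L lborel h = Gamma (Re x)" .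
  have le: "norm (g t) \<le> h t" for t
  proof (cases "t > 0")
    case True
    have "Re (\<rho> / complex_of_real t) \<ge> 0"
      using assms(1) True by (simp add: Re_divide_of_real)
    then have "exp (- t - Re (\<rho> / complex_of_real t)) \<le> inverse (exp t)"
      by (simp flip: exp_minus)
    then show ?thesis
      using True by (simp add: g_def h_def norm_mult norm_powr_real_powr divide_inverse mult_left_mono)
  qed (auto simp: g_def h_def)
  (* By convention the integral of g is 0 if g is not integrable, and then the bound is trivial. *)
  have "norm (integral\<^sup>L lborel g) \<le> integral\<^sup>L lborel h"
  proof (cases "integrable lborel g")
    case True
    have "norm (integral\<^sup>L lborel g) \<le> (\<integral>t. norm (g t) \<partial>lborel)"
      by (rule integral_norm_bound)
    also have "\<dots> \<le> integral\<^sup>L lborel h"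
      using True hi le by (intro integral_mono) auto
    finally show ?thesis .
  next
    case False
    have "0 \<le> integral\<^sup>L lborel h" by (intro integral_nonneg_AE) (auto simp: h_def)
    then show ?thesis using False by (simp add: not_integrable_integral_eq)
  qed
  then show ?thesis
    unfolding h_eq by (simp add: Gamma_ext_def set_lebesgue_integral_def g_def)
qed

section \<open>Lower bounds for Pochhammer symbols\<close>

text \<open>Every factor after the first is at least 1.\<close>
lemma pochhammer_ge_min:
  fixes a :: real
  assumes "a > 0"
  shows   "min 1 a \<le> pochhammer a n"
proof (induction n)
  case (Suc n)
  show ?case
  proof (cases n)
    case (Suc m)
    have "min 1 a \<le> pochhammer a n" by (fact Suc.IH)
    also have "\<dots> \<le> pochhammer a n * (a + of_nat n)"
      using assms \<open>n = Suc m\<close> pochhammer_pos[OF assms, of n] by (simp add: mult_le_cancel_left1)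
    finally show ?thesis by (simp add: pochhammer_Suc)
  qed simp
qed simp

lemma pochhammer_Re_le_norm:
  assumes "Re s \<ge> 0"
  shows   "pochhammer (Re s) n \<le> norm (pochhammer s n)"
proof (induction n)
  case (Suc n)
  have "Re s + of_nat n \<le> norm (s + of_nat n)"
    using complex_Re_le_cmod[of "s + of_nat n"] by simp
  then show ?case
    using Suc assms by (auto simp: pochhammer_Suc norm_mult intro!: mult_mono)
qed simp

lemma pochhammer_nonzero_of_Re_pos:
  assumes "Re s > 0"
  shows   "pochhammer s n \<noteq> (0::complex)"
  using pochhammer_Re_le_norm[of s n] pochhammer_pos[of "Re s" n] assms by auto

lemma norm_inverse_pochhammer_le:
  assumes "Re s > 0"
  shows   "norm (inverse (pochhammer s n)) \<le> inverse (min 1 (Re s))"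
  using pochhammer_ge_min[of "Re s" n] pochhammer_Re_le_norm[of s n] assms
  unfolding norm_inverse by (intro le_imp_inverse_le) auto

section \<open>Convergence of the four parameter Bessel series\<close>

text \<open>
  The increment of the argument of \<open>\<Gamma>\<^sub>\<rho>\<close> by 2 costs a factor of order \<open>n\<^sup>2\<close>, while the three
  factors of the denominator gain \<open>n\<^sup>4\<close>, so the ratio of consecutive terms tends to 0.  The bound
  \<open>Re x > -2\<close> makes \<open>Re x + 2 * n\<close> positive from \<open>n = 1\<close> on; the term for \<open>n = 0\<close> is irrelevant
  to convergence, and there \<open>\<Gamma>(Re x)\<close> may fail to bound it.
\<close>
lemma summable_Bessel_G_coeffs:
  fixes \<rho> \<kappa> s x u :: complex
  assumes "Re \<rho> \<ge> 0" "Re s > 0" "Re x > -2"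
  shows   "summable (\<lambda>n. norm (u ^ n * (Gamma_ext \<rho> (x + 2 * of_nat n)
             / (fact n * pochhammer s n * pochhammer s (2 * n)))))"
proof -
  define y \<sigma> where "y = Re x" "\<sigma> = Re s"
  (* R exceeds the norm of u so that the majorant B is positive also for u = 0. *)
  define R where "R = norm u + 1"
  define B where "B = (\<lambda>n::nat. R ^ n * (Gamma (y + 2 * of_nat n) /
     (fact n * pochhammer \<sigma> n * pochhammer \<sigma> (2 * n))))"
  have R: "R > 0" by (simp add: R_def add_nonneg_pos)
  have \<sigma>: "\<sigma> > 0" using assms by (simp add: y_\<sigma>_def)
  have y: "y > -2" using assms by (simp add: y_\<sigma>_def)
  have Bpos: "B n > 0" if "n \<ge> 1" for n
    using that R \<sigma> y by (auto simp: B_def intro!: mult_pos_pos divide_pos_pos Gamma_real_pos pochhammer_pos)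
  define q where "q = (\<lambda>n. R * (y + 2 * real n) * (y + 2 * real n + 1) /
      ((real n + 1) * (\<sigma> + real n) * (\<sigma> + 2 * real n) * (\<sigma> + 2 * real n + 1)))"
  have step: "B (Suc n) = q n * B n" if n: "n \<ge> 1" for n
  proof -
    have pos: "y + 2 * real n > 0" using y n by simp
    have "Gamma (y + 2 * real n + 1 + 1) = (y + 2 * real n + 1) * Gamma (y + 2 * real n + 1)"
      using pos by (intro Gamma_plus1) (auto elim!: nonpos_Ints_cases)
    also have "Gamma (y + 2 * real n + 1) = (y + 2 * real n) * Gamma (y + 2 * real n)"
      using pos by (intro Gamma_plus1) (auto elim!: nonpos_Ints_cases)
    finally have G: "Gamma (y + 2 * real (Suc n)) = (y + 2 * real n + 1) * ((y + 2 * real n) * Gamma (y + 2 * real n))"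
      by (simp add: add_ac)
    have "pochhammer \<sigma> (2 * Suc n) = pochhammer \<sigma> (2 * n) * (\<sigma> + 2 * n) * (\<sigma> + 2 * n + 1)"
      by (simp add: pochhammer_Suc add_ac)
    then show ?thesis
      unfolding B_def G q_def by (simp add: pochhammer_Suc field_simps)
  qed
  have "q \<longlonglongrightarrow> 0"
    unfolding q_def by real_asymp
  then have "\<forall>\<^sub>F n in sequentially. q n < 1/2"
    by (rule order_tendstoD) simp
  then obtain N :: nat where N: "\<And>n. n \<ge> N \<Longrightarrow> q n < 1/2"
    by (auto simp: eventually_sequentially)
  have B: "summable B"
  proof (rule summable_ratio_test[of "1/2" "max N 1"])
    fix n assume "max N 1 \<le> n"
    then have n: "n \<ge> N" "n \<ge> 1" by auto
    have "B (Suc n) \<le> 1/2 * B n"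
      unfolding step[OF n(2)] using N[OF n(1)] Bpos[OF n(2)] by (intro mult_right_mono) auto
    then show "norm (B (Suc n)) \<le> 1/2 * norm (B n)"
      using Bpos[OF n(2)] Bpos[of "Suc n"] by simp
  qed simp
  show ?thesis
  proof (rule summable_comparison_test_ev[OF _ B], rule eventually_sequentiallyI[of 1])
    fix n :: nat assume n: "n \<ge> 1"
    have 1: "norm u ^ n \<le> R ^ n" by (intro power_mono) (auto simp: R_def)
    have 2: "norm (Gamma_ext \<rho> (x + 2 * of_nat n)) \<le> Gamma (y + 2 * of_nat n)"
      using norm_Gamma_ext_le[of \<rho> "x + 2 * of_nat n"] assms n by (simp add: y_\<sigma>_def)
    have 3: "pochhammer \<sigma> n \<le> norm (pochhammer s n)" for n
      using pochhammer_Re_le_norm[of s n] assms by (simp add: y_\<sigma>_def)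
    have 4: "pochhammer \<sigma> n > 0" for n using \<sigma> by (rule pochhammer_pos)
    have 5: "Gamma (y + 2 * of_nat n) \<ge> 0"
      using y n by (intro less_imp_le Gamma_real_pos) simp
    have "norm (u ^ n * (Gamma_ext \<rho> (x + 2 * of_nat n)
             / (fact n * pochhammer s n * pochhammer s (2 * n)))) \<le> B n"
      unfolding B_def norm_mult norm_divide norm_power norm_fact
      using 1 2 3 4 5 R by (intro mult_mono frac_le mult_pos_pos) (auto intro: less_imp_le)
    then show "norm (norm (u ^ n * (Gamma_ext \<rho> (x + 2 * of_nat n)
             / (fact n * pochhammer s n * pochhammer s (2 * n))))) \<le> B n"
      by (simp only: real_norm_def abs_norm_cancel)
  qed
qed

section \<open>Expansion of a power in Bessel functions\<close>

lemma summable_norm_exp_terms: "summable (\<lambda>k. norm (u ^ k / fact k :: complex))"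
  using summable_exp[of "norm u"] by (simp add: norm_divide norm_power field_simps)

text \<open>
  In terms of the confluent hypergeometric limit function this is
  \<open>\<^sub>0F\<^sub>1(; s + m; - u) / (s)\<^sub>m\<close>.  It is a Bessel function freed of its power of \<open>z\<close> and
  of a Gamma factor that depends on neither \<open>m\<close> nor the summation index; keeping \<open>(s)\<^sub>m\<close> inside
  makes the total degree \<open>m + k\<close> visible, on which the cancellation depends.
\<close>
definition scaled_0F1 :: "complex \<Rightarrow> nat \<Rightarrow> complex \<Rightarrow> complex" where
  "scaled_0F1 s m u = (\<Sum>k. (- u) ^ k / fact k * inverse (pochhammer s (m + k)))"

lemma scaled_0F1_term_le:
  assumes "Re s > 0"
  shows "norm ((- u) ^ k / fact k * inverse (pochhammer s (m + k)))
           \<le> norm (u ^ k / fact k) * inverse (min 1 (Re s))"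
  unfolding norm_mult
  using norm_inverse_pochhammer_le[OF assms, of "m + k"]
  by (intro mult_mono) (auto simp: norm_divide norm_power)

lemma scaled_0F1_summable:
  assumes "Re s > 0"
  shows "summable (\<lambda>k. norm ((- u) ^ k / fact k * inverse (pochhammer s (m + k))))"
  by (rule summable_comparison_test[OF _ summable_mult2[OF summable_norm_exp_terms[of u], of "inverse (min 1 (Re s))"]])
     (use scaled_0F1_term_le[OF assms] in auto)

lemma norm_scaled_0F1_le:
  assumes "Re s > 0"
  shows "norm (scaled_0F1 s m u) \<le> exp (norm u) * inverse (min 1 (Re s))"
proof -
  have "norm (scaled_0F1 s m u)
          \<le> (\<Sum>k. norm ((- u) ^ k / fact k * inverse (pochhammer s (m + k))))"
    unfolding scaled_0F1_def by (rule summable_norm[OF scaled_0F1_summable[OF assms]])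
  also have "\<dots> \<le> (\<Sum>k. norm (u ^ k / fact k) * inverse (min 1 (Re s)))"
    by (intro suminf_le scaled_0F1_term_le scaled_0F1_summable summable_mult2 summable_norm_exp_terms assms)
  also have "\<dots> = exp (norm u) * inverse (min 1 (Re s))"
    using summable_norm_exp_terms[of u]
    by (subst suminf_mult2 [symmetric])
       (auto simp: exp_def norm_divide norm_power field_simps)
  finally show ?thesis .
qed

lemma norm_summable_on_Times_mult:
  fixes f :: "'a \<Rightarrow> complex" and g :: "'b \<Rightarrow> complex"
  assumes "(\<lambda>x. norm (f x)) summable_on A" "(\<lambda>y. norm (g y)) summable_on B"
  shows   "(\<lambda>p. norm ((\<lambda>(x, y). f x * g y) p)) summable_on A \<times> B"
  using assms
  by (subst Infinite_Sum.abs_summable_on_Sigma_iff)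
     (auto simp: norm_mult infsum_cmult_right' abs_mult infsum_nonneg intro!: summable_on_cmult_right summable_on_cmult_left)

text \<open>
  Collecting the terms with \<open>m + k = N\<close> gives
  \<open>u\<^sup>N / (N! (s)\<^sub>N) * (\<Sum>k\<le>N. (-1)\<^sup>k (N choose k))\<close>, and the sum in it is the
  expansion of \<open>(1 - 1)\<^sup>N\<close>.
\<close>
lemma infsum_scaled_0F1_eq_1:
  assumes "Re s > 0"
  shows   "(\<Sum>\<^sub>\<infinity>m. u ^ m / fact m * scaled_0F1 s m u) = 1"
proof -
  define f where "f = (\<lambda>(m, k). u ^ m / fact m * ((- u) ^ k / fact k * inverse (pochhammer s (m + k))))"
  have "(\<lambda>p. norm ((\<lambda>(m, k). (u ^ m / fact m) * (u ^ k / fact k)) p)) summable_on UNIV \<times> (UNIV :: nat set)"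
    using summable_norm_exp_terms[of u]
    by (intro norm_summable_on_Times_mult)
       (auto simp: summable_on_UNIV_nonneg_real_iff)
  then have "(\<lambda>p. norm ((\<lambda>(m, k). (u ^ m / fact m) * (u ^ k / fact k)) p) * inverse (min 1 (Re s)))
     summable_on UNIV \<times> (UNIV :: nat set)"
    by (intro summable_on_cmult_left) auto
  then have "(\<lambda>p. norm (f p)) summable_on UNIV \<times> UNIV"
  proof (rule Infinite_Sum.abs_summable_on_comparison_test', clarify)
    fix m k :: nat
    show "norm (f (m, k)) \<le> norm ((u ^ m / fact m) * (u ^ k / fact k)) * inverse (min 1 (Re s))"
      using mult_left_mono[OF scaled_0F1_term_le[OF assms, of u k m], of "norm (u ^ m / fact m)"]
      unfolding f_def split norm_mult by (simp add: mult_ac)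
  qed
  then have f: "f summable_on UNIV \<times> UNIV" by (rule Infinite_Sum.abs_summable_summable)
  have bij: "bij_betw (\<lambda>(N, k). (N - k, k)) (SIGMA N:UNIV. {..N}) (UNIV \<times> UNIV :: (nat \<times> nat) set)"
    by (rule bij_betwI[of _ _ _ "\<lambda>(m, k). (m + k, k)"]) auto
  have "(\<Sum>\<^sub>\<infinity>m. u ^ m / fact m * scaled_0F1 s m u) = (\<Sum>\<^sub>\<infinity>m. \<Sum>\<^sub>\<infinity>k. f (m, k))"
  proof (rule infsum_cong)
    fix m :: nat
    have "((\<lambda>k. (- u) ^ k / fact k * inverse (pochhammer s (m + k))) has_sum scaled_0F1 s m u) UNIV"
      unfolding scaled_0F1_def using scaled_0F1_summable[OF assms, of u m]
      by (intro norm_summable_imp_has_sum[OF _ summable_sums]) (auto dest: summable_norm_cancel)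
    then show "u ^ m / fact m * scaled_0F1 s m u = (\<Sum>\<^sub>\<infinity>k. f (m, k))"
      unfolding f_def split by (intro infsumI [symmetric] has_sum_cmult_right)
  qed
  also have "\<dots> = infsum f (UNIV \<times> UNIV)"
    using f by (rule infsum_Sigma_banach)
  also have "\<dots> = (\<Sum>\<^sub>\<infinity>(N, k)\<in>(SIGMA N:UNIV. {..N}). f (N - k, k))"
    by (subst infsum_reindex_bij_betw[OF bij, symmetric]) (simp add: case_prod_unfold)
  also have "\<dots> = (\<Sum>\<^sub>\<infinity>N. \<Sum>\<^sub>\<infinity>k\<in>{..N}. f (N - k, k))"
    using f unfolding summable_on_reindex_bij_betw[OF bij, symmetric]
    by (subst infsum_Sigma_banach [symmetric]) (auto simp: case_prod_unfold)
  also have "\<dots> = (\<Sum>\<^sub>\<infinity>N::nat. if N = 0 then 1 else 0)"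
  proof (rule infsum_cong)
    fix N :: nat
    have "(\<Sum>\<^sub>\<infinity>k\<in>{..N}. f (N - k, k)) = (\<Sum>k\<le>N. f (N - k, k))" by simp
    also have "\<dots> = (\<Sum>k\<le>N. u ^ N / (fact N * pochhammer s N) * ((-1) ^ k * of_nat (N choose k)))"
    proof (rule sum.cong)
      fix k assume "k \<in> {..N}"
      then have k: "k \<le> N" by simp
      then have "u ^ N = u ^ (N - k) * u ^ k" by (simp flip: power_add)
      then show "f (N - k, k) = u ^ N / (fact N * pochhammer s N) * ((-1) ^ k * of_nat (N choose k))"
        using k by (simp add: f_def binomial_fact power_minus[of u] field_simps)
    qed simp
    also have "\<dots> = u ^ N / (fact N * pochhammer s N) * (\<Sum>k\<le>N. (-1) ^ k * of_nat (N choose k))"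
      by (rule sum_distrib_left [symmetric])
    also have "\<dots> = (if N = 0 then 1 else 0)"
      by (simp add: choose_alternating_sum)
    finally show "(\<Sum>\<^sub>\<infinity>k\<in>{..N}. f (N - k, k)) = (if N = 0 then 1 else 0)" .
  qed
  also have "\<dots> = (\<Sum>\<^sub>\<infinity>N\<in>{0::nat}. 1)"
    by (rule infsum_cong_neutral) auto
  finally show ?thesis by simp
qed

text \<open>
  The order of the Bessel function is split as \<open>(\<mu> + n) + m\<close>: the part \<open>n\<close> goes into
  the base \<open>\<mu> + 1 + n\<close> of the Pochhammer symbols and is cancelled by \<open>(\<mu> + 1)\<^sub>n\<close>, and \<open>m\<close> is the
  index to be summed.
\<close>
lemma Bessel_J_eq_scaled_0F1:
  assumes "Re \<mu> > -1" "z \<noteq> 0"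
  shows "Gamma (\<mu> + 1) * pochhammer (\<mu> + 1) n * Bessel_J (\<mu> + of_nat m + of_nat n) z
          = (z / 2) powr \<mu> * (z / 2) ^ (m + n) * scaled_0F1 (\<mu> + 1 + of_nat n) m ((z / 2)\<^sup>2)"
proof -
  define w where "w = z / 2"
  have w: "w \<noteq> 0" using assms by (simp add: w_def)
  have s: "\<mu> + 1 \<notin> \<int>\<^sub>\<le>\<^sub>0" using assms by (auto elim!: nonpos_Ints_cases simp: complex_eq_iff)
  have s': "Re (\<mu> + 1) > 0" "Re (\<mu> + 1 + of_nat n) > 0" using assms by auto
  have G: "Gamma (\<mu> + 1) \<noteq> 0" using s by (simp add: Gamma_eq_zero_iff)
  have P: "pochhammer (\<mu> + 1) n \<noteq> 0" by (rule pochhammer_nonzero_of_Re_pos) (use s' in simp)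
  define C where "C = w powr \<mu> * w ^ (m + n) / (Gamma (\<mu> + 1) * pochhammer (\<mu> + 1) n)"
  have "Bessel_J (\<mu> + of_nat m + of_nat n) z =
     (\<Sum>k. C * ((- w\<^sup>2) ^ k / fact k * inverse (pochhammer (\<mu> + 1 + of_nat n) (m + k))))"
    unfolding Bessel_J_def
  proof (rule suminf_cong)
    fix k :: nat
    have "w powr (2 * of_nat k + (\<mu> + of_nat m + of_nat n)) = w powr (\<mu> + of_nat (2 * k + m + n))"
      by (simp add: algebra_simps)
    also have "\<dots> = w powr \<mu> * w ^ (2 * k + m + n)"
      using w by (simp only: powr_add powr_nat if_False)
    finally have 1: "w powr (2 * of_nat k + (\<mu> + of_nat m + of_nat n)) = w powr \<mu> * w ^ (2 * k + m + n)" .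
    have "Gamma (\<mu> + 1 + of_nat (n + (m + k))) = Gamma (\<mu> + 1) * pochhammer (\<mu> + 1) (n + (m + k))"
      using pochhammer_Gamma[OF s, of "n + (m + k)"] G by simp
    then have 2: "Gamma (\<mu> + of_nat m + of_nat n + of_nat k + 1) =
        Gamma (\<mu> + 1) * (pochhammer (\<mu> + 1) n * pochhammer (\<mu> + 1 + of_nat n) (m + k))"
      unfolding pochhammer_product' by (simp add: algebra_simps)
    show "(- 1) ^ k / (fact k * Gamma (\<mu> + of_nat m + of_nat n + of_nat k + 1)) *
         (z / 2) powr (2 * of_nat k + (\<mu> + of_nat m + of_nat n)) =
         C * ((- w\<^sup>2) ^ k / fact k * inverse (pochhammer (\<mu> + 1 + of_nat n) (m + k)))"
      unfolding 2 w_def [symmetric] 1 C_def power_minus[of "w\<^sup>2"]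
      by (simp add: power_add field_simps flip: power_mult)
  qed
  also have "\<dots> = C * scaled_0F1 (\<mu> + 1 + of_nat n) m (w\<^sup>2)"
    unfolding scaled_0F1_def
    by (rule suminf_mult[OF summable_norm_cancel[OF scaled_0F1_summable[OF s'(2)]]])
  finally show ?thesis using G P by (simp add: C_def w_def)
qed

section \<open>The double expansion\<close>

text \<open>
  Fubini for series, translated from unordered sums to the ordered sums of the theorem.
\<close>
lemma norm_summable_on_iterated:
  fixes a :: "nat \<Rightarrow> nat \<Rightarrow> complex"
  assumes "(\<lambda>p. norm ((\<lambda>(m, n). a m n) p)) summable_on UNIV \<times> UNIV"
  shows   "iterated_summable a" "(\<Sum>m. \<Sum>n. a m n) = (\<Sum>\<^sub>\<infinity>n. \<Sum>\<^sub>\<infinity>m. a m n)"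
proof -
  have sm: "(\<lambda>(m, n). a m n) summable_on UNIV \<times> UNIV"
    using assms by (rule Infinite_Sum.abs_summable_summable)
  have row: "a m summable_on UNIV" for m
    using summable_on_SigmaD1[OF sm, of m] by simp
  have row_eq: "(\<Sum>n. a m n) = (\<Sum>\<^sub>\<infinity>n. a m n)" for m
    using has_sum_imp_sums[OF has_sum_infsum[OF row]] by (simp add: sums_iff)
  have col: "(\<lambda>m. \<Sum>\<^sub>\<infinity>n. a m n) summable_on UNIV"
    using summable_on_SigmaD[OF sm] row by simp
  show "iterated_summable a"
    unfolding iterated_summable_def row_eq
    using row col summable_on_imp_summable by auto
  have "(\<Sum>m. \<Sum>n. a m n) = (\<Sum>\<^sub>\<infinity>m. \<Sum>\<^sub>\<infinity>n. a m n)"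
    unfolding row_eq using has_sum_imp_sums[OF has_sum_infsum[OF col]] by (simp add: sums_iff)
  also have "\<dots> = (\<Sum>\<^sub>\<infinity>n. \<Sum>\<^sub>\<infinity>m. a m n)"
    using sm by (rule infsum_swap_banach)
  finally show "(\<Sum>m. \<Sum>n. a m n) = (\<Sum>\<^sub>\<infinity>n. \<Sum>\<^sub>\<infinity>m. a m n)" .
qed

text \<open>
  The common core of both expansions.  An arbitrary absolutely summable \<open>e\<close> takes the place
  of the terms of the series on the left-hand side; the factor \<open>(z / 2)\<^sup>m / (z / 2)\<^sup>n\<close> is chosen
  such that the sum over \<open>m\<close> returns \<open>e n\<close> up to the constant \<open>Gamma (\<mu> + 1)\<close>.
\<close>
lemma double_Bessel_expansion:
  fixes e :: "nat \<Rightarrow> complex"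
  assumes \<mu>: "Re \<mu> > -1" and z: "z \<noteq> 0" and e: "summable (\<lambda>n. norm (e n))"
  defines "a \<equiv> \<lambda>m n. (z / 2) powr (- \<mu>) * (z / 2) ^ m / (z / 2) ^ n
                 * Bessel_J (\<mu> + of_nat m + of_nat n) z * pochhammer (\<mu> + 1) n * e n / fact m"
  shows "iterated_summable a" "Gamma (\<mu> + 1) * (\<Sum>m. \<Sum>n. a m n) = (\<Sum>n. e n)"
proof -
  define w where "w = z / 2"
  define u where "u = w\<^sup>2"
  have w: "w \<noteq> 0" using z by (simp add: w_def)
  define G where "G = Gamma (\<mu> + 1)"
  have G: "G \<noteq> 0" using \<mu> unfolding G_def Gamma_eq_zero_iff
    by (auto elim!: nonpos_Ints_cases simp: complex_eq_iff)
  have s: "Re (\<mu> + 1 + of_nat n) > 0" for n using \<mu> by simp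
  have a_eq: "a m n = e n / G * (u ^ m / fact m * scaled_0F1 (\<mu> + 1 + of_nat n) m u)" for m n
  proof -
    have "a m n = (z / 2) powr (- \<mu>) * (z / 2) ^ m / (z / 2) ^ n * e n / (fact m * G) *
            (Gamma (\<mu> + 1) * pochhammer (\<mu> + 1) n * Bessel_J (\<mu> + of_nat m + of_nat n) z)"
      using G by (simp add: a_def G_def field_simps)
    also have "\<dots> = e n / G * (u ^ m / fact m * scaled_0F1 (\<mu> + 1 + of_nat n) m u)"
      unfolding Bessel_J_eq_scaled_0F1[OF \<mu> z] u_def w_def [symmetric]
      using w G by (simp add: powr_minus power_add power2_eq_square power_mult_distrib field_simps)
    finally show ?thesis .
  qed
  (* The bound at n = 0 serves for all n, since the base of the Pochhammer symbols only moves right. *)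
  define K where "K = exp (norm u) * inverse (min 1 (Re (\<mu> + 1)))"
  have K: "norm (scaled_0F1 (\<mu> + 1 + of_nat n) m u) \<le> K" for m n
  proof -
    have "inverse (min 1 (Re (\<mu> + 1 + of_nat n))) \<le> inverse (min 1 (Re (\<mu> + 1)))"
      using \<mu> by (intro le_imp_inverse_le) auto
    then show ?thesis
      using norm_scaled_0F1_le[OF s, of n m u] unfolding K_def
      by (meson exp_ge_zero mult_left_mono order_trans)
  qed
  have "(\<lambda>p. norm ((\<lambda>(m, n). (u ^ m / fact m) * e n) p)) summable_on UNIV \<times> UNIV"
    using summable_norm_exp_terms[of u] e
    by (intro norm_summable_on_Times_mult) (auto simp: summable_on_UNIV_nonneg_real_iff)
  then have "(\<lambda>p. norm ((\<lambda>(m, n). (u ^ m / fact m) * e n) p) * (K / norm G)) summable_on UNIV \<times> UNIV"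
    by (intro summable_on_cmult_left) auto
  then have abs: "(\<lambda>p. norm ((\<lambda>(m, n). a m n) p)) summable_on UNIV \<times> UNIV"
  proof (rule Infinite_Sum.abs_summable_on_comparison_test', clarify)
    fix m n :: nat
    have "norm (a m n) = norm (u ^ m / fact m * e n) / norm G * norm (scaled_0F1 (\<mu> + 1 + of_nat n) m u)"
      unfolding a_eq by (simp add: norm_mult norm_divide mult_ac)
    also have "\<dots> \<le> norm (u ^ m / fact m * e n) / norm G * K"
      by (intro mult_left_mono K) auto
    finally show "norm (a m n) \<le> norm (u ^ m / fact m * e n) * (K / norm G)"
      by simp
  qed
  show "iterated_summable a" by (rule norm_summable_on_iterated(1)[OF abs])
  have "(\<Sum>m. \<Sum>n. a m n) = (\<Sum>\<^sub>\<infinity>n. \<Sum>\<^sub>\<infinity>m. a m n)"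
    by (rule norm_summable_on_iterated(2)[OF abs])
  also have "\<dots> = (\<Sum>\<^sub>\<infinity>n. e n / G)"
    unfolding a_eq infsum_cmult_right' infsum_scaled_0F1_eq_1[OF s] by simp
  also have "\<dots> = (\<Sum>\<^sub>\<infinity>n. e n) / G"
    by (simp add: divide_inverse infsum_cmult_left')
  also have "(\<Sum>\<^sub>\<infinity>n. e n) = (\<Sum>n. e n)"
    by (rule infsumI[OF norm_summable_imp_has_sum[OF e summable_sums[OF summable_norm_cancel[OF e]]]])
  finally show "Gamma (\<mu> + 1) * (\<Sum>m. \<Sum>n. a m n) = (\<Sum>n. e n)"
    using G by (simp add: G_def)
qed


section \<open>Spherical Bessel and Bessel-Clifford functions\<close>

text \<open>
  Pulling \<open>Gamma (\<nu> + 1)\<close> out of both Gamma factors turns them into the Pochhammer symbols that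
  occur in the double series.
\<close>
lemma Bessel_G_via_pochhammer:
  fixes b c z \<nu> \<rho> :: complex
  assumes "Re \<rho> \<ge> 0" "Re \<nu> > -1" "Re (c + \<nu>) > -2" "z \<noteq> 0"
  defines "e \<equiv> \<lambda>k. (- b * (z / 2)\<^sup>2) ^ k * poch_ext c \<rho> (2 * of_nat k + \<nu>)
             / (fact k * pochhammer (\<nu> + 1) k * pochhammer (\<nu> + 1) (2 * k))"
  shows "summable (\<lambda>k. norm (e k))"
    and "Bessel_G \<nu> b c z \<rho> = (z / 2) powr \<nu> / (Gamma (\<nu> + 1))\<^sup>2 * (\<Sum>k. e k)"
proof -
  have s: "Re (\<nu> + 1) > 0" using assms by simp
  have s': "\<nu> + 1 \<notin> \<int>\<^sub>\<le>\<^sub>0"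
    using s by (auto elim!: nonpos_Ints_cases simp: complex_eq_iff)
  have G: "Gamma (\<nu> + 1) \<noteq> 0" using s' by (simp add: Gamma_eq_zero_iff)
  have "summable (\<lambda>n. norm ((- b * (z / 2)\<^sup>2) ^ n * (Gamma_ext \<rho> ((c + \<nu>) + 2 * of_nat n)
             / (fact n * pochhammer (\<nu> + 1) n * pochhammer (\<nu> + 1) (2 * n)))) / norm (Gamma c))"
    using assms(1) s assms(3) by (intro summable_divide summable_Bessel_G_coeffs)
  also have "(\<lambda>n. norm ((- b * (z / 2)\<^sup>2) ^ n * (Gamma_ext \<rho> ((c + \<nu>) + 2 * of_nat n)
             / (fact n * pochhammer (\<nu> + 1) n * pochhammer (\<nu> + 1) (2 * n)))) / norm (Gamma c))
           = (\<lambda>k. norm (e k))"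
    by (intro ext) (simp add: e_def poch_ext_def norm_mult norm_divide add_ac mult_ac)
  finally show sm: "summable (\<lambda>k. norm (e k))" .
  have "Bessel_G \<nu> b c z \<rho> = (\<Sum>k. (z / 2) powr \<nu> / (Gamma (\<nu> + 1))\<^sup>2 * e k)"
    unfolding Bessel_G_def
  proof (rule suminf_cong)
    fix k :: nat
    have "(z / 2) powr (2 * of_nat k + \<nu>) = (z / 2) powr of_nat (2 * k) * (z / 2) powr \<nu>"
      by (simp add: powr_add)
    also have "(z / 2) powr of_nat (2 * k) = ((z / 2)\<^sup>2) ^ k"
      using assms(4) by (subst powr_nat') (auto simp: power_mult)
    finally have 1: "(z / 2) powr (2 * of_nat k + \<nu>) = ((z / 2)\<^sup>2) ^ k * (z / 2) powr \<nu>" .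
    have 2: "Gamma (\<nu> + of_nat k + 1) = Gamma (\<nu> + 1) * pochhammer (\<nu> + 1) k"
      using pochhammer_Gamma[OF s', of k] G by (simp add: add_ac)
    have 3: "Gamma (\<nu> + 2 * of_nat k + 1) = Gamma (\<nu> + 1) * pochhammer (\<nu> + 1) (2 * k)"
      using pochhammer_Gamma[OF s', of "2 * k"] G by (simp add: add_ac)
    show "(- b) ^ k * poch_ext c \<rho> (2 * of_nat k + \<nu>)
           / (Gamma (\<nu> + of_nat k + 1) * Gamma (\<nu> + 2 * of_nat k + 1))
           * ((z / 2) powr (2 * of_nat k + \<nu>) / fact k)
         = (z / 2) powr \<nu> / (Gamma (\<nu> + 1))\<^sup>2 * e k"
      unfolding 1 2 3 e_def power_mult_distrib by (simp add: power2_eq_square mult_ac)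
  qed
  also have "\<dots> = (z / 2) powr \<nu> / (Gamma (\<nu> + 1))\<^sup>2 * (\<Sum>k. e k)"
    by (rule suminf_mult[OF summable_norm_cancel[OF sm]])
  finally show "Bessel_G \<nu> b c z \<rho> = (z / 2) powr \<nu> / (Gamma (\<nu> + 1))\<^sup>2 * (\<Sum>k. e k)" .
qed

lemma pochhammer_minus_of_nat_add:
  "pochhammer (- of_nat m - of_nat n) n = ((-1) ^ n * fact (m + n) / fact m :: complex)"
proof -
  have "fact (m + n) = (fact m * pochhammer (1 + of_nat m) n :: complex)"
    by (simp add: pochhammer_fact pochhammer_product')
  then have "pochhammer (of_nat m + 1) n = (fact (m + n) / fact m :: complex)"
    by (simp add: add_ac)
  then show ?thesis
    using pochhammer_minus[of "of_nat m + of_nat n :: complex" n] by simp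
qed

text \<open>
  The cut plane is needed here: \<open>inverse w powr (1/2) = w powr (- 1/2)\<close> fails for
  negative real \<open>w\<close>.
\<close>
lemma csqrt_pi_over_twice:
  assumes "z \<notin> \<real>\<^sub>\<le>\<^sub>0"
  shows "csqrt (of_real pi / (2 * z)) = of_real (sqrt pi) / 2 * (z / 2) powr (- 1/2)"
proof -
  have w: "z / 2 \<notin> \<real>\<^sub>\<le>\<^sub>0" using assms by (auto simp: complex_nonpos_Reals_iff)
  then have w0: "z / 2 \<noteq> 0" by auto
  have "csqrt (of_real pi / (2 * z)) = (of_real (pi / 4) * inverse (z / 2)) powr (1/2)"
    by (simp add: csqrt_conv_powr field_simps)
  also have "\<dots> = of_real (pi / 4) powr (1/2) * inverse (z / 2) powr (1/2)"
    by (rule powr_times_real_left) auto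
  also have "of_real (pi / 4) powr (1/2) = csqrt (of_real (pi / 4))"
    by (simp add: csqrt_conv_powr)
  also have "\<dots> = of_real (sqrt (pi / 4))" by (simp flip: of_real_sqrt)
  also have "sqrt (pi / 4) = sqrt pi / 2" by (simp add: real_sqrt_divide)
  also have "inverse (z / 2) powr (1/2) = (z / 2) powr (- 1/2)"
    using w w0 by (simp add: powr_def Ln_inverse del: inverse_divide)
  finally show ?thesis by simp
qed

text \<open>
  The argument of \<open>csqrt z\<close> lies within \<open>pi/2\<close> of 0, so the principal logarithm of
  \<open>csqrt z\<close> is exactly half of that of \<open>z\<close>.
\<close>
lemma csqrt_powr:
  assumes "z \<noteq> 0"
  shows "csqrt z powr a = z powr (a / 2)"
proof -
  have "Ln (csqrt z) = Ln z / 2"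
    using assms Im_Ln_le_pi[OF assms] mpi_less_Im_Ln[OF assms]
    by (subst csqrt_exp_Ln) auto
  then show ?thesis using assms by (simp add: powr_def del: eq_divide_eq_numeral1)
qed

theorem theorem6p7:
  fixes b \<rho> z :: complex
  assumes "Re \<rho> > 0" and "z \<notin> \<real>\<^sub>\<le>\<^sub>0"
  shows
    "(\<forall>\<mu> \<nu> c :: complex. Re \<mu> > -1 \<longrightarrow> Re \<nu> > -3/2 \<longrightarrow> Re c > 1/2 \<longrightarrow>
       (let a = (\<lambda>m n :: nat.
              (z / 2) powr (\<nu> - \<mu> + of_nat m + of_nat n)
              * Bessel_J (\<mu> + of_nat m + of_nat n) z
              * (pochhammer (- of_nat m - of_nat n) n * b ^ n
                  * poch_ext (c - 1/2) \<rho> (2 * of_nat n + \<nu> + 1/2) * pochhammer (\<mu> + 1) n)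
              / (fact n * pochhammer (\<nu> + 3/2) n * pochhammer (\<nu> + 3/2) (2 * n) * fact (m + n)))
        in iterated_summable a \<and>
           spherical_g \<nu> b c z \<rho>
             = of_real (sqrt pi) / 2 * (Gamma (\<mu> + 1) / (Gamma (\<nu> + 3/2))\<^sup>2)
                 * (\<Sum>m. \<Sum>n. a m n)))
     \<and>
     (\<forall>\<nu> \<kappa> :: complex. Re \<nu> > -1 \<longrightarrow> Re \<kappa> > 0 \<longrightarrow>
       (let a = (\<lambda>m n :: nat.
              z ^ m * 2 powi (int n - int m) * Bessel_J (of_nat m + of_nat n) z
              * pochhammer (- of_nat m - of_nat n) n * (- b) ^ n
              * poch_ext \<kappa> \<rho> (\<nu> + 2 * of_nat n)
              / (fact (m + n) * (-1) ^ n * pochhammer (\<nu> + 1) n * pochhammer (\<nu> + 1) (2 * n)))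
        in iterated_summable a \<and>
           Bessel_Clifford \<nu> b \<kappa> z \<rho> = 1 / (Gamma (\<nu> + 1))\<^sup>2 * (\<Sum>m. \<Sum>n. a m n)))"
proof (intro conjI allI impI, goal_cases)
  case (1 \<mu> \<nu> c)
  define w where "w = z / 2"
  have z: "z \<noteq> 0" using assms(2) by auto
  then have w: "w \<noteq> 0" by (simp add: w_def)
  define e where "e = (\<lambda>k. (- b * w\<^sup>2) ^ k * poch_ext (c - 1/2) \<rho> (2 * of_nat k + (\<nu> + 1/2))
             / (fact k * pochhammer ((\<nu> + 1/2) + 1) k * pochhammer ((\<nu> + 1/2) + 1) (2 * k)))"
  define a where "a = (\<lambda>m n. w powr (- \<mu>) * w ^ m / w ^ n
                 * Bessel_J (\<mu> + of_nat m + of_nat n) z * pochhammer (\<mu> + 1) n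
                 * (w powr \<nu> * e n) / fact m)"
  have half: "\<nu> + 1/2 + 1 = \<nu> + 3/2" by simp
  have e: "summable (\<lambda>n. norm (e n))"
    and BG: "Bessel_G (\<nu> + 1/2) b (c - 1/2) z \<rho> = w powr (\<nu> + 1/2) / (Gamma (\<nu> + 3/2))\<^sup>2 * (\<Sum>n. e n)"
    using Bessel_G_via_pochhammer[OF less_imp_le[OF assms(1)] _ _ z, of "\<nu> + 1/2" "c - 1/2" b] 1 unfolding e_def w_def half by auto
  have e': "summable (\<lambda>n. norm (w powr \<nu> * e n))"
    using e by (simp add: norm_mult summable_mult)
  have a: "iterated_summable a" "Gamma (\<mu> + 1) * (\<Sum>m. \<Sum>n. a m n) = (\<Sum>n. w powr \<nu> * e n)"
    using double_Bessel_expansion[OF 1(1) z e'] unfolding a_def w_def by blast+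
  have a_eq: "(z / 2) powr (\<nu> - \<mu> + of_nat m + of_nat n)
              * Bessel_J (\<mu> + of_nat m + of_nat n) z
              * (pochhammer (- of_nat m - of_nat n) n * b ^ n
                  * poch_ext (c - 1/2) \<rho> (2 * of_nat n + \<nu> + 1/2) * pochhammer (\<mu> + 1) n)
              / (fact n * pochhammer (\<nu> + 3/2) n * pochhammer (\<nu> + 3/2) (2 * n) * fact (m + n)) = a m n" for m n
  proof -
    have "w powr (\<nu> - \<mu> + of_nat m + of_nat n) = w powr (\<nu> + - \<mu> + of_nat (m + n))"
      by (simp add: add_ac)
    also have "\<dots> = w powr \<nu> * w powr (- \<mu>) * w ^ (m + n)"
      using w by (simp only: powr_add powr_nat if_False)
    finally have *: "w powr (\<nu> - \<mu> + of_nat m + of_nat n) = w powr \<nu> * w powr (- \<mu>) * w ^ (m + n)" .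
    have wn: "w ^ (m + n) = w ^ m / w ^ n * (w\<^sup>2) ^ n"
      using w by (simp add: power_add power2_eq_square power_mult_distrib)
    show ?thesis
      unfolding w_def[symmetric] * wn pochhammer_minus_of_nat_add a_def e_def half power_mult_distrib power_minus[of b]
      by (simp add: mult_ac add_ac)
  qed
  have "w powr (\<nu> + 1/2) * w powr (- 1/2) = w powr \<nu>"
    by (simp flip: powr_add)
  then have "spherical_g \<nu> b c z \<rho> = of_real (sqrt pi) / 2 * (1 / (Gamma (\<nu> + 3/2))\<^sup>2) * (w powr \<nu> * (\<Sum>n. e n))"
    unfolding spherical_g_def BG csqrt_pi_over_twice[OF assms(2)] w_def [symmetric]
    by (simp add: mult_ac)
  also have "w powr \<nu> * (\<Sum>n. e n) = Gamma (\<mu> + 1) * (\<Sum>m. \<Sum>n. a m n)"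
    unfolding a(2) by (rule suminf_mult[OF summable_norm_cancel[OF e], symmetric])
  finally show ?case
    unfolding Let_def a_eq using a(1) by (simp add: mult_ac)
next
  case (2 \<nu> \<kappa>)
  have z: "z \<noteq> 0" using assms(2) by auto
  (* The second expansion is the case \<mu> = 0 of the double expansion, where (\<mu> + 1)_n = n! cancels
     the n! in e.  The Bessel function G is taken at 2 * csqrt z, and the square of half of that is z. *)
  define e where "e = (\<lambda>k. (- b * z) ^ k * poch_ext \<kappa> \<rho> (2 * of_nat k + \<nu>)
             / (fact k * pochhammer (\<nu> + 1) k * pochhammer (\<nu> + 1) (2 * k)))"
  define a where "a = (\<lambda>m n. (z / 2) powr (- 0) * (z / 2) ^ m / (z / 2) ^ n
                 * Bessel_J (0 + of_nat m + of_nat n) z * pochhammer (0 + 1) n * e n / fact m)"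
  have z': "2 * csqrt z \<noteq> 0" using z by simp
  have e: "summable (\<lambda>n. norm (e n))"
    and BG: "Bessel_G \<nu> b \<kappa> (2 * csqrt z) \<rho> = csqrt z powr \<nu> / (Gamma (\<nu> + 1))\<^sup>2 * (\<Sum>n. e n)"
    using Bessel_G_via_pochhammer[OF less_imp_le[OF assms(1)] _ _ z', of \<nu> \<kappa> b] 2 unfolding e_def by auto
  have a: "iterated_summable a" "Gamma (0 + 1) * (\<Sum>m. \<Sum>n. a m n) = (\<Sum>n. e n)"
    using double_Bessel_expansion[OF _ z e, of 0] unfolding a_def by auto
  have a_eq: "z ^ m * 2 powi (int n - int m) * Bessel_J (of_nat m + of_nat n) z
              * pochhammer (- of_nat m - of_nat n) n * (- b) ^ n
              * poch_ext \<kappa> \<rho> (\<nu> + 2 * of_nat n)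
              / (fact (m + n) * (-1) ^ n * pochhammer (\<nu> + 1) n * pochhammer (\<nu> + 1) (2 * n)) = a m n" for m n
  proof -
    have "(2 :: complex) powi (int n - int m) = 2 ^ n / 2 ^ m"
      by (simp add: power_int_diff)
    then have "z ^ m * 2 powi (int n - int m) = (z / 2) ^ m / (z / 2) ^ n * z ^ n"
      using z by (simp add: power_divide)
    moreover have "pochhammer 1 n = (fact n :: complex)" by (simp add: pochhammer_fact)
    ultimately show ?thesis
      unfolding pochhammer_minus_of_nat_add a_def e_def power_mult_distrib
      using z by (simp add: mult_ac add_ac)
  qed
  have "z powr (- \<nu> / 2) * csqrt z powr \<nu> = 1"
    using z by (simp add: csqrt_powr flip: powr_add)
  then have "Bessel_Clifford \<nu> b \<kappa> z \<rho> = 1 / (Gamma (\<nu> + 1))\<^sup>2 * (\<Sum>n. e n)"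
    unfolding Bessel_Clifford_def BG by (simp add: mult_ac)
  then show ?case
    unfolding Let_def a_eq using a by simp
qed

end
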